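(* Let $\alpha>0$ and let $f\in C^\infty(0,\infty)$ have support $[a,b]$ with $0<a<b<\infty$. For $\nu=0$ the fractional Bessel integral on the semiaxis coincides with the Liouville fractional integral of order $2\alpha$: for all $x>0$ $$ (B_{0,-}^{-\alpha}f)(x)=\frac{1}{\Gamma(2\alpha)}\int_x^{\infty}(y-x)^{2\alpha-1}f(y)\,dy=(I_{-}^{2\alpha}f)(x). $$
   Context: For $\nu\ge 0$, $\alpha>0$ the fractional Bessel integral on the semiaxis $(0,\infty)$ is defined by $$ (B_{\nu,-}^{-\alpha}f)(x)=\frac{1}{\Gamma(2\alpha)}\int_x^{+\infty}\left(\frac{y^2-x^2}{2y}\right)^{2\alpha-1}{}_2F_1\left(\alpha+\frac{\nu-1}{2},\alpha;2\alpha;1-\frac{x^2}{y^2}\right)f(y)\,dy,\qquad x>0, $$ where ${}_2F_1$ is the Gauss hypergeometric function. The Liouville fractional integral of order $\gamma>0$ is $(I_-^{\gamma}f)(x)=\frac{1}{\Gamma(\gamma)}\int_x^\infty (y-x)^{\gamma-1}f(y)\,dy$. *)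

theory Defs
  imports "HOL-Analysis.Analysis"
begin

(* The Gauss series, which represents the hypergeometric function on the unit disc only.
   Here its argument 1 - x^2/y^2 with 0 < x < y always lies in (0, 1). *)
definition gauss_2F1 :: "'a \<Rightarrow> 'a \<Rightarrow> 'a \<Rightarrow> 'a \<Rightarrow> 'a :: {banach, real_normed_field}" where
  "gauss_2F1 a b c z = eval_fps (fps_hypergeo [a, b] [c] 1) z"

lemma gauss_2F1_altdef:
  "gauss_2F1 a b c z =
     (\<Sum>n. pochhammer a n * pochhammer b n / (pochhammer c n * fact n) * z ^ n)"
  by (simp add: gauss_2F1_def eval_fps_def)

definition bessel_kernel :: "real \<Rightarrow> real \<Rightarrow> real \<Rightarrow> real \<Rightarrow> real" where
  "bessel_kernel \<nu> \<alpha> x y =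
     ((y\<^sup>2 - x\<^sup>2) / (2 * y)) powr (2 * \<alpha> - 1) *
     gauss_2F1 (\<alpha> + (\<nu> - 1) / 2) \<alpha> (2 * \<alpha>) (1 - x\<^sup>2 / y\<^sup>2)"

(* B_{\<nu>,-}^{-\<alpha>}, meant for \<nu> \<ge> 0, \<alpha> > 0, x > 0.  The value type covers both real- and
   complex-valued f. *)
definition bessel_integral ::
  "real \<Rightarrow> real \<Rightarrow> (real \<Rightarrow> 'a) \<Rightarrow> real \<Rightarrow> 'a :: euclidean_space" where
  "bessel_integral \<nu> \<alpha> f x =
     (1 / Gamma (2 * \<alpha>)) *\<^sub>R
       set_lebesgue_integral lborel {x<..} (\<lambda>y. bessel_kernel \<nu> \<alpha> x y *\<^sub>R f y)"

definition liouville_integral ::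
  "real \<Rightarrow> (real \<Rightarrow> 'a) \<Rightarrow> real \<Rightarrow> 'a :: euclidean_space" where
  "liouville_integral \<gamma> f x =
     (1 / Gamma \<gamma>) *\<^sub>R
       set_lebesgue_integral lborel {x<..} (\<lambda>y. (y - x) powr (\<gamma> - 1) *\<^sub>R f y)"

(* Intended for open S: then every iterated derivative at a point of S depends only on the
   values of f in S. *)
definition smooth_on_open :: "real set \<Rightarrow> (real \<Rightarrow> 'a :: real_normed_vector) \<Rightarrow> bool" where
  "smooth_on_open S f \<longleftrightarrow>
     (\<forall>n. ((\<lambda>g t. vector_derivative g (at t)) ^^ n) f differentiable_on S)"

(* The support is the closure relative to S, as f is regarded as a function on S only. *)
definition support_in :: "'b :: topological_space set \<Rightarrow> ('b \<Rightarrow> 'a :: real_normed_vector) \<Rightarrow> 'b set"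
  where "support_in S f = top_of_set S closure_of support_on S f"

end

theory Submission
  imports Defs "HOL-Real_Asymp.Real_Asymp"
begin

text \<open>For \<nu> = 0 the Gauss function in the kernel is elementary: 2F1(\<alpha> - 1/2,
  \<alpha>; 2\<alpha>; z) = (2 / (1 + sqrt(1 - z)))^(2\<alpha> - 1) for 0 \<le> z < 1
  (\<open>gauss_2F1_half_shift\<close>). At z = 1 - x^2/y^2 the root is x/y, so the base on the
  right is 2y/(x + y); multiplied by (y^2 - x^2)/(2y) it gives y - x. Hence the two kernels agree
  pointwise for y > x (\<open>bessel_kernel_0\<close>), and so do the integrals.

  The closed form rests on a differential equation. The series satisfies the hypergeometric
  equation, which is its coefficient recurrence in disguise (\<open>fps_hypergeo_2F1_ode\<close>,
  \<open>eval_fps_2F1_ode\<close>); the elementary function satisfies it by direct computation. By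
  Abel's identity the Wronskian times t^c (1 - t)^(a + b + 1 - c) is constant, and since c =
  2\<alpha> > 0 that constant is its value 0 at the origin. So the quotient of the two solutions is
  constant, and both equal 1 at 0.

  The integrals converge because 2\<alpha> - 1 > -1 and f is bounded and vanishes beyond b
  (\<open>set_integrable_powr_scaleR\<close>).\<close>

section \<open>The Gauss series and its differential equation\<close>

lemma fps_conv_radius_2F1:
  fixes a b c :: real
  assumes c: "\<And>n. c + of_nat n \<noteq> 0"
  shows "fps_conv_radius (fps_hypergeo [a, b] [c] 1) \<ge> 1"
proof (cases "\<exists>k. a = - of_nat k \<or> b = - of_nat k")
  \<comment> \<open>The series terminates. This case is separate because the ratio test below
    divides by coefficients; for the parameters used later it occurs at \<alpha> = 1/2.\<close>
  case True
  then obtain k where k: "a = - of_nat k \<or> b = - of_nat k"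
    by blast
  have "eventually (\<lambda>n. fps_nth (fps_hypergeo [a, b] [c] 1) n = 0) sequentially"
    using eventually_gt_at_top[of k]
    by eventually_elim (use k in \<open>auto simp: pochhammer_eq_0_iff\<close>)
  then have "conv_radius (fps_nth (fps_hypergeo [a, b] [c] 1)) = conv_radius (\<lambda>_. 0 :: real)"
    by (rule conv_radius_cong')
  then show ?thesis
    by (simp add: fps_conv_radius_def)
next
  case False
  have nz: "a + of_nat n \<noteq> 0" "b + of_nat n \<noteq> 0" for n
    using False by (metis add_eq_0_iff2)+
  have pnz: "pochhammer a n \<noteq> 0" "pochhammer b n \<noteq> 0" "pochhammer c n \<noteq> 0" for n
    using False c by (simp_all add: pochhammer_eq_0_iff eq_neg_iff_add_eq_0)
  have "fps_nth (fps_hypergeo [a, b] [c] 1) n / fps_nth (fps_hypergeo [a, b] [c] 1) (Suc n)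
      = (c + of_nat n) * (1 + of_nat n) / ((a + of_nat n) * (b + of_nat n))" for n
    using nz[of n] pnz[of n] c[of n]
    by (simp add: pochhammer_Suc divide_simps) (simp add: algebra_simps)
  moreover have "(\<lambda>n. (c + of_nat n) * (1 + of_nat n) / ((a + of_nat n) * (b + of_nat n))) \<longlonglongrightarrow> 1"
    by real_asymp
  ultimately have "(\<lambda>n. fps_nth (fps_hypergeo [a, b] [c] 1) n / fps_nth (fps_hypergeo [a, b] [c] 1) (Suc n)) \<longlonglongrightarrow> 1"
    by simp
  from tendsto_norm[OF this]
  have "conv_radius (fps_nth (fps_hypergeo [a, b] [c] 1)) = ereal 1"
    by (intro conv_radius_ratio_limit_nonzero)
      (simp_all only: norm_divide norm_one zero_neq_one not_False_eq_True one_ereal_def)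
  then show ?thesis
    by (simp add: fps_conv_radius_def)
qed

text \<open>Comparing coefficients of degree n turns the equation into the recurrence (c + n)(1 + n)
  G_(n+1) = (a + n)(b + n) G_n.\<close>

lemma fps_hypergeo_2F1_ode:
  fixes a b c :: real
  assumes c: "\<And>n. c + of_nat n \<noteq> 0"
  defines "G \<equiv> fps_hypergeo [a, b] [c] 1"
  shows "fps_X * (1 - fps_X) * fps_deriv (fps_deriv G)
     + (fps_const c - fps_const (a + b + 1) * fps_X) * fps_deriv G - fps_const (a * b) * G = 0"
proof (rule fps_ext)
  fix n
  have rec: "(c + of_nat n) * (1 + of_nat n) * fps_nth G (Suc n) = (a + of_nat n) * (b + of_nat n) * fps_nth G n" for n
    unfolding G_def using c[of n] by (simp add: fps_hypergeo_rec del: fps_hypergeo_nth)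
  show "fps_nth (fps_X * (1 - fps_X) * fps_deriv (fps_deriv G)
     + (fps_const c - fps_const (a + b + 1) * fps_X) * fps_deriv G - fps_const (a * b) * G) n = fps_nth 0 n"
    \<comment> \<open>The factor X(1 - X) shifts indices by one and by two, so degrees 0 and 1 are
      treated apart from the rest.\<close>
    using rec[of n] by (cases n; cases "n - 1") (simp_all add: algebra_simps)
qed

text \<open>Evaluation respects sums and products only within the radii of convergence.
  Differentiation does not shrink the radius and polynomial coefficients have infinite radius, so
  the formal identity carries over to the whole unit disc.\<close>

lemma eval_fps_2F1_ode:
  fixes a b c z :: real
  assumes c: "\<And>n. c + of_nat n \<noteq> 0" and z: "\<bar>z\<bar> < 1"
  defines "G \<equiv> fps_hypergeo [a, b] [c] 1"
  shows "z * (1 - z) * eval_fps (fps_deriv (fps_deriv G)) z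
     + (c - (a + b + 1) * z) * eval_fps (fps_deriv G) z = a * b * eval_fps G z"
proof -
  have "1 \<le> fps_conv_radius G"
    unfolding G_def by (rule fps_conv_radius_2F1) (rule c)
  moreover have "ereal (norm z) < 1"
    using z by (simp add: one_ereal_def)
  ultimately have G: "ereal (norm z) < fps_conv_radius G"
    by (rule order.strict_trans2[rotated])
  then have G1: "ereal (norm z) < fps_conv_radius (fps_deriv G)"
    by (rule order.strict_trans2[OF _ fps_conv_radius_deriv])
  then have G2: "ereal (norm z) < fps_conv_radius (fps_deriv (fps_deriv G))"
    by (rule order.strict_trans2[OF _ fps_conv_radius_deriv])
  have poly: "fps_conv_radius (fps_X * (1 - fps_X) :: real fps) = \<infinity>"
    "fps_conv_radius (1 - fps_X :: real fps) = \<infinity>"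
    "fps_conv_radius (fps_const c - fps_const (a + b + 1) * fps_X :: real fps) = \<infinity>"
    "fps_conv_radius (fps_const (a + b + 1) * fps_X :: real fps) = \<infinity>"
    using fps_conv_radius_mult[of "fps_X :: real fps" "1 - fps_X"]
      fps_conv_radius_diff[of "1 :: real fps" "fps_X"]
      fps_conv_radius_diff[of "fps_const c" "fps_const (a + b + 1) * fps_X"]
      fps_conv_radius_mult[of "fps_const (a + b + 1)" "fps_X"]
    by auto
  have prods: "ereal (norm z) < fps_conv_radius (fps_X * (1 - fps_X) * fps_deriv (fps_deriv G))"
    "ereal (norm z) < fps_conv_radius ((fps_const c - fps_const (a + b + 1) * fps_X) * fps_deriv G)"
    "ereal (norm z) < fps_conv_radius (fps_const (a * b) * G)"
    by (rule order.strict_trans2[OF _ fps_conv_radius_mult]; use G G1 G2 in \<open>simp add: poly\<close>)+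
  have sum: "ereal (norm z) < fps_conv_radius (fps_X * (1 - fps_X) * fps_deriv (fps_deriv G)
     + (fps_const c - fps_const (a + b + 1) * fps_X) * fps_deriv G)"
    by (rule order.strict_trans2[OF _ fps_conv_radius_add]) (use prods in simp)
  have "eval_fps (fps_X * (1 - fps_X) * fps_deriv (fps_deriv G)
     + (fps_const c - fps_const (a + b + 1) * fps_X) * fps_deriv G - fps_const (a * b) * G) z = 0"
    unfolding G_def fps_hypergeo_2F1_ode[OF c] by (rule eval_fps_0)
  also have "eval_fps (fps_X * (1 - fps_X) * fps_deriv (fps_deriv G)
     + (fps_const c - fps_const (a + b + 1) * fps_X) * fps_deriv G - fps_const (a * b) * G) z
    = eval_fps (fps_X * (1 - fps_X)) z * eval_fps (fps_deriv (fps_deriv G)) z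
     + eval_fps (fps_const c - fps_const (a + b + 1) * fps_X) z * eval_fps (fps_deriv G) z
     - a * b * eval_fps G z"
    using G G1 G2
    by (simp only: eval_fps_diff[OF sum prods(3)] eval_fps_add[OF prods(1,2)] eval_fps_mult
        eval_fps_const poly fps_conv_radius_const less_ereal.simps)
  also have "\<dots> = z * (1 - z) * eval_fps (fps_deriv (fps_deriv G)) z
     + (c - (a + b + 1) * z) * eval_fps (fps_deriv G) z - a * b * eval_fps G z"
    by (simp add: eval_fps_mult eval_fps_diff poly del: fps_const_add)
  finally show ?thesis
    by simp
qed

section \<open>Closed form of the Gauss function at \<nu> = 0\<close>

text \<open>The right-hand side solves the same hypergeometric equation as the series.  The weight of the
  self-adjoint form of that equation vanishes at the origin, so the Wronskian is identically zero
  and the two solutions are proportional.\<close>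
lemma gauss_2F1_half_shift:
  fixes \<alpha> z :: real
  assumes \<alpha>: "\<alpha> > 0" and z: "0 \<le> z" "z < 1"
  shows "gauss_2F1 (\<alpha> - 1 / 2) \<alpha> (2 * \<alpha>) z = (2 / (1 + sqrt (1 - z))) powr (2 * \<alpha> - 1)"
proof (cases "z = 0")
  case True
  then show ?thesis
    by (simp add: gauss_2F1_def eval_fps_at_0)
next
  case False
  define r where "r = 2 * \<alpha> - 1"
  define c where "c = 2 * \<alpha>"
  define G where "G = fps_hypergeo [\<alpha> - 1 / 2, \<alpha>] [c] 1"
  define g where "g = eval_fps G"
  define g1 where "g1 = eval_fps (fps_deriv G)"
  define g2 where "g2 = eval_fps (fps_deriv (fps_deriv G))"
  define F where "F = (\<lambda>t::real. (2 / (1 + sqrt (1 - t))) powr r)"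
  \<comment> \<open>\<open>k\<close> is the logarithmic derivative of \<open>F\<close>, so F' = k F
    and F'' = (k' + k^2) F; \<open>k1\<close> is k'. The weight \<open>p\<close> is t^c (1 - t)^(a +
    b + 1 - c), whose second exponent is 1/2 here, and \<open>w\<close> is the weighted
    Wronskian.\<close>
  define k where "k = (\<lambda>t::real. r / (2 * sqrt (1 - t) * (1 + sqrt (1 - t))))"
  define k1 where "k1 = (\<lambda>t::real. r * (1 + 2 * sqrt (1 - t)) / (4 * sqrt (1 - t) ^ 3 * (1 + sqrt (1 - t))\<^sup>2))"
  define p where "p = (\<lambda>t::real. t powr c * sqrt (1 - t))"
  define w where "w = (\<lambda>t. p t * (g t * (k t * F t) - g1 t * F t))"
  have cn: "c + of_nat n \<noteq> 0" for n
    using \<alpha> unfolding c_def by (metis add_pos_nonneg mult_pos_pos of_nat_0_le_iff order_less_irrefl zero_less_numeral)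
  have "1 \<le> fps_conv_radius G"
    unfolding G_def by (rule fps_conv_radius_2F1) (rule cn)
  then have conv: "ereal (norm t) < fps_conv_radius G" if "\<bar>t\<bar> < 1" for t :: real
    by (rule order.strict_trans2[rotated]) (use that in \<open>simp add: one_ereal_def\<close>)
  then have conv1: "ereal (norm t) < fps_conv_radius (fps_deriv G)" if "\<bar>t\<bar> < 1" for t :: real
    by (rule order.strict_trans2[OF _ fps_conv_radius_deriv]) (use that in auto)
  have dg: "(g has_real_derivative g1 t) (at t within A)" if "\<bar>t\<bar> < 1" for t A
    unfolding g_def g1_def by (rule has_field_derivative_eval_fps) (rule conv[OF that])
  have dg1: "(g1 has_real_derivative g2 t) (at t within A)" if "\<bar>t\<bar> < 1" for t A
    unfolding g1_def g2_def by (rule has_field_derivative_eval_fps) (rule conv1[OF that])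
  have Fpos: "F t > 0" if "t < 1" for t
  proof -
    have "1 + sqrt (1 - t) > 0"
      using that by (simp add: add_pos_nonneg)
    then show ?thesis
      unfolding F_def by simp
  qed
  have ds: "((\<lambda>t. sqrt (1 - t)) has_real_derivative - 1 / (2 * sqrt (1 - t))) (at t)" if "t < 1" for t
    using that by (auto intro!: derivative_eq_intros simp: field_simps)
  have dF: "(F has_real_derivative k t * F t) (at t)" if "t < 1" for t
  proof -
    have s: "1 + sqrt (1 - t) > 0" "1 + sqrt (1 - t) \<noteq> 0" "2 + 2 * sqrt (1 - t) \<noteq> 0"
      "sqrt (1 - t) \<noteq> 0"
      using that by (simp_all add: add_pos_nonneg add_nonneg_eq_0_iff)
    show ?thesis
      unfolding F_def k_def using that
      by (auto intro!: derivative_eq_intros ds simp: powr_diff s)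
         (simp add: s divide_simps power2_eq_square)
  qed
  have dk: "(k has_real_derivative k1 t) (at t)" if "t < 1" for t
  proof -
    have s: "1 + sqrt (1 - t) \<noteq> 0" "sqrt (1 - t) \<noteq> 0"
      using that by (simp_all add: add_nonneg_eq_0_iff)
    show ?thesis
      unfolding k_def k1_def using that
      by (auto intro!: derivative_eq_intros ds simp: s)
         (simp add: s divide_simps power2_eq_square power3_eq_cube, simp add: algebra_simps)
  qed
  have dp: "(p has_real_derivative t powr c / (t * sqrt (1 - t)) * (c - (c + 1 / 2) * t)) (at t)"
    if "0 < t" "t < 1" for t
  proof -
    have "sqrt (1 - t) > 0" "sqrt (1 - t) * sqrt (1 - t) = 1 - t"
      using that by simp_all
    then show ?thesis
      unfolding p_def using that(1)
      by (auto intro!: derivative_eq_intros ds that simp: powr_diff)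
        (simp add: divide_simps, simp add: algebra_simps)
  qed
  have odeG: "t * (1 - t) * g2 t + (c - (c + 1 / 2) * t) * g1 t = (\<alpha> - 1 / 2) * \<alpha> * g t"
    if "\<bar>t\<bar> < 1" for t
    using eval_fps_2F1_ode[OF cn that, of "\<alpha> - 1 / 2" \<alpha>]
    unfolding G_def [symmetric] g_def[symmetric] g1_def[symmetric] g2_def[symmetric]
    by (simp add: c_def add.commute)
  \<comment> \<open>The equation for \<open>F\<close> divided by \<open>F\<close>, that is, its
    Riccati form. Substituting t = 1 - s^2 makes it a rational identity in s and r.\<close>
  have odeF: "t * (1 - t) * (k1 t + k t ^ 2) + (c - (c + 1 / 2) * t) * k t = (\<alpha> - 1 / 2) * \<alpha>"
    if "\<bar>t\<bar> < 1" for t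
  proof -
    define s where "s = sqrt (1 - t)"
    have s: "s > 0" "1 + s > 0" and t: "t = 1 - s\<^sup>2"
      using that by (simp_all add: s_def add_pos_nonneg)
    have \<alpha>': "\<alpha> = (r + 1) / 2" "c = r + 1"
      by (simp_all add: r_def c_def)
    show ?thesis
      unfolding k_def k1_def s_def[symmetric] \<alpha>' t using s
      by (simp add: divide_simps power2_eq_square power3_eq_cube) algebra
  qed
  have dw: "(w has_real_derivative 0) (at t)" if t: "0 < t" "t < 1" for t
  proof -
    have t': "\<bar>t\<bar> < 1"
      using t by simp
    \<comment> \<open>With this factor p = e t(1 - t) and p' = e (c - (c + 1/2) t), so
      \<open>e\<close> factors out of w' and leaves a combination of the two differential
      equations.\<close>
    define e where "e = t powr c / (t * sqrt (1 - t))"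
    have pt: "p t = e * (t * (1 - t))"
      using t by (simp add: p_def e_def divide_simps)
    have "(w has_real_derivative e *
       ((c - (c + 1 / 2) * t) * (g t * (k t * F t) - g1 t * F t)
        + t * (1 - t) * (g t * ((k1 t + k t ^ 2) * F t) - g2 t * F t))) (at t)"
      unfolding w_def
      by (rule derivative_eq_intros dp dg dg1 dF dk t t' refl)+
        (unfold pt e_def[symmetric], algebra)
    also have "(c - (c + 1 / 2) * t) * (g t * (k t * F t) - g1 t * F t)
        + t * (1 - t) * (g t * ((k1 t + k t ^ 2) * F t) - g2 t * F t) = 0"
      using odeF[OF t'] odeG[OF t'] by algebra
    finally show ?thesis by simp
  qed
  have w0: "w t = 0" if t: "0 < t" "t < 1" for t
  proof -
    \<comment> \<open>The derivative of \<open>w\<close> is known only for t > 0. Continuity at 0,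
      where \<open>p\<close> vanishes since c > 0, fixes the constant.\<close>
    have "continuous_on {0..t} p"
      unfolding p_def using \<alpha>
      by (intro continuous_on_mult continuous_on_powr' continuous_intros) (auto simp: c_def)
    moreover have "continuous_on {0..t} g" "continuous_on {0..t} g1" "continuous_on {0..t} F" "continuous_on {0..t} k"
      by (rule DERIV_continuous_on, rule dg dg1 dF[THEN DERIV_subset] dk[THEN DERIV_subset]; use t in auto)+
    ultimately have "continuous_on {0..t} w"
      unfolding w_def by (intro continuous_intros)
    then have "w t = w 0"
      using t by (intro DERIV_isconst_end dw) auto
    also have "w 0 = 0"
      using \<alpha> by (simp add: w_def p_def c_def)
    finally show ?thesis .
  qed
  have "g z / F z = g 0 / F 0"
  proof (rule DERIV_isconst_end[of 0 z "\<lambda>t. g t / F t"])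
    show "continuous_on {0..z} (\<lambda>t. g t / F t)"
    proof (intro continuous_on_divide)
      show "continuous_on {0..z} g" "continuous_on {0..z} F"
        by (rule DERIV_continuous_on, rule dg dF[THEN DERIV_subset]; use z in auto)+
      show "\<forall>t\<in>{0..z}. F t \<noteq> 0"
        using Fpos z by (auto simp: less_le)
    qed
    fix t assume t: "0 < t" "t < z"
    \<comment> \<open>Dividing by the positive weight leaves a vanishing Wronskian, the numerator of
      (g/F)' up to sign.\<close>
    have "p t > 0"
      using t z by (simp add: p_def)
    then have "g t * (k t * F t) - g1 t * F t = 0"
      using w0[of t] t z by (simp add: w_def)
    then show "((\<lambda>t. g t / F t) has_real_derivative 0) (at t)"
      using t z Fpos[of t] by (auto intro!: derivative_eq_intros dg dF)
  qed (use z False in simp)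
  moreover have "g 0 = 1" "F 0 = 1"
    by (simp_all add: g_def F_def G_def eval_fps_at_0)
  ultimately show ?thesis
    using Fpos[of z] z by (simp add: gauss_2F1_def g_def G_def c_def F_def r_def)
qed

section \<open>Identification of the kernels\<close>

lemma bessel_kernel_0:
  assumes "\<alpha> > 0" and x: "0 < x" "x < y"
  shows "bessel_kernel 0 \<alpha> x y = (y - x) powr (2 * \<alpha> - 1)"
proof -
  have "x\<^sup>2 / y\<^sup>2 \<le> 1"
    using x by (simp add: power_mono)
  moreover have "0 < x\<^sup>2 / y\<^sup>2"
    using x by simp
  ultimately have "gauss_2F1 (\<alpha> - 1 / 2) \<alpha> (2 * \<alpha>) (1 - x\<^sup>2 / y\<^sup>2)
      = (2 / (1 + sqrt (x\<^sup>2 / y\<^sup>2))) powr (2 * \<alpha> - 1)"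
    using gauss_2F1_half_shift[of \<alpha> "1 - x\<^sup>2 / y\<^sup>2"] assms(1) by simp
  also have "sqrt (x\<^sup>2 / y\<^sup>2) = x / y"
    using x by (simp add: real_sqrt_divide)
  \<comment> \<open>Both bases are nonnegative, so the two powers with exponent 2\<alpha> - 1
    merge.\<close>
  finally have "bessel_kernel 0 \<alpha> x y
      = ((y\<^sup>2 - x\<^sup>2) / (2 * y) * (2 / (1 + x / y))) powr (2 * \<alpha> - 1)"
    using x by (simp add: bessel_kernel_def powr_mult power_mono del: times_divide_times_eq times_divide_eq_left times_divide_eq_right)
  also have "(y\<^sup>2 - x\<^sup>2) / (2 * y) * (2 / (1 + x / y)) = y - x"
    using x by (simp add: divide_simps power2_eq_square) (simp add: algebra_simps)
  finally show ?thesis .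
qed

section \<open>Integrability and conclusion\<close>

lemma set_integrable_powr_shift:
  fixes x B :: real
  assumes "\<gamma> > 0"
  shows "set_integrable lborel {x<..B} (\<lambda>y. (y - x) powr (\<gamma> - 1))"
proof (cases "x \<le> B")
  case True
  have "(\<lambda>t. t powr (\<gamma> - 1)) absolutely_integrable_on {0<..B - x}"
    using assms True
    by (intro nonnegative_absolutely_integrable_1 integrable_on_powr_from_0') auto
  then have "integrable lborel (\<lambda>t. indicator {0<..B - x} t *\<^sub>R t powr (\<gamma> - 1))"
    unfolding set_integrable_def by (subst (asm) integrable_completion) auto
  \<comment> \<open>Translation t = y - x moves the singularity from 0 to x.\<close>
  from lborel_integrable_real_affine[OF this, of 1 "-x"] show ?thesis
    unfolding set_integrable_def by (simp add: indicator_def if_distrib cong: if_cong)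
qed (simp add: set_integrable_def)

lemma set_integrable_powr_scaleR:
  fixes f :: "real \<Rightarrow> 'a :: euclidean_space"
  assumes "\<gamma> > 0" and "continuous_on {x<..} f"
    and bound: "\<And>y. y > x \<Longrightarrow> norm (f y) \<le> M"
    and zero: "\<And>y. y > x \<Longrightarrow> y > B \<Longrightarrow> f y = 0"
  shows "set_integrable lborel {x<..} (\<lambda>y. (y - x) powr (\<gamma> - 1) *\<^sub>R f y)"
proof (rule set_integrable_bound)
  \<comment> \<open>The dominating function is the power cut off at \<open>B\<close>: without the
    cutoff it is not integrable at infinity.\<close>
  have "(\<lambda>y. indicator {x<..B} y *\<^sub>R (y - x) powr (\<gamma> - 1))
      = (\<lambda>y. indicator {x<..} y *\<^sub>R (indicator {..B} y * (y - x) powr (\<gamma> - 1)))"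
    by (auto simp: indicator_def)
  then have "set_integrable lborel {x<..} (\<lambda>y. indicator {..B} y * (y - x) powr (\<gamma> - 1))"
    using set_integrable_powr_shift[OF assms(1), of x B] by (simp only: set_integrable_def)
  then show "set_integrable lborel {x<..} (\<lambda>y. M * (indicator {..B} y * (y - x) powr (\<gamma> - 1)))"
    by (intro set_integrable_mult_right)
  have "continuous_on {x<..} (\<lambda>y. (y - x) powr (\<gamma> - 1) *\<^sub>R f y)"
    by (intro continuous_intros assms) auto
  then show "set_borel_measurable lborel {x<..} (\<lambda>y. (y - x) powr (\<gamma> - 1) *\<^sub>R f y)"
    unfolding set_borel_measurable_def
    using borel_measurable_continuous_on_indicator[of "{x<..}"]
    by (simp del: scaleR_scaleR)
  have "norm ((y - x) powr (\<gamma> - 1) *\<^sub>R f y) \<le> norm (M * (indicator {..B} y * (y - x) powr (\<gamma> - 1)))"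
    if "y > x" for y
  proof (cases "y \<le> B")
    case True
    have "norm (f y) \<le> \<bar>M\<bar>"
      using bound[OF that] by linarith
    with True show ?thesis
      by (simp add: abs_mult mult.commute mult_right_mono)
  qed (use zero that in auto)
  then show "AE y in lborel. y \<in> {x<..} \<longrightarrow> norm ((y - x) powr (\<gamma> - 1) *\<^sub>R f y)
      \<le> norm (M * (indicator {..B} y * (y - x) powr (\<gamma> - 1)))"
    by simp
qed

lemma smooth_on_open_imp_continuous_on:
  "smooth_on_open S f \<Longrightarrow> continuous_on S f"
  unfolding smooth_on_open_def
  by (metis differentiable_imp_continuous_on funpow_0)

lemma eq_0_outside_support_in:
  assumes "y \<in> S" "y \<notin> support_in S f"
  shows "f y = 0"
proof -
  have "support_on S f \<subseteq> support_in S f"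
    unfolding support_in_def by (rule closure_of_subset) (auto simp: in_support_on)
  then show ?thesis
    using assms by (auto simp: in_support_on)
qed

theorem mainTheorem2:
  fixes f :: "real \<Rightarrow> 'a :: euclidean_space" and \<alpha> a b x :: real
  assumes "\<alpha> > 0"
    and "0 < a" and "a < b"
    and "smooth_on_open {0<..} f"
    and "support_in {0<..} f = {a..b}"
    and "x > 0"
  shows
    "set_integrable lborel {x<..} (\<lambda>y. bessel_kernel 0 \<alpha> x y *\<^sub>R f y)
    \<and> set_integrable lborel {x<..} (\<lambda>y. (y - x) powr (2 * \<alpha> - 1) *\<^sub>R f y)
    \<and> bessel_integral 0 \<alpha> f x =
           (1 / Gamma (2 * \<alpha>)) *\<^sub>R
             set_lebesgue_integral lborel {x<..} (\<lambda>y. (y - x) powr (2 * \<alpha> - 1) *\<^sub>R f y)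
    \<and> (1 / Gamma (2 * \<alpha>)) *\<^sub>R
             set_lebesgue_integral lborel {x<..} (\<lambda>y. (y - x) powr (2 * \<alpha> - 1) *\<^sub>R f y)
           = liouville_integral (2 * \<alpha>) f x"
proof -
  have cont: "continuous_on {0<..} f"
    using assms(4) by (rule smooth_on_open_imp_continuous_on)
  have zero: "f y = 0" if "y > 0" "y \<notin> {a..b}" for y
    using eq_0_outside_support_in[of y "{0<..}" f] that assms(5) by simp
  \<comment> \<open>As a > 0, the compact interval lies inside the open half-line where f is
    continuous; off it f is 0, so the bound holds for all y > x.\<close>
  have "bounded (f ` {a..b})"
    using assms(2) by (intro compact_imp_bounded compact_continuous_image
        continuous_on_subset[OF cont]) auto
  then obtain M where M: "M > 0" "\<And>y. y \<in> {a..b} \<Longrightarrow> norm (f y) \<le> M"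
    unfolding bounded_pos by auto
  have bound: "norm (f y) \<le> M" if "y > x" for y
    using M zero[of y] that assms(6) by (cases "y \<in> {a..b}") auto
  \<comment> \<open>Integrability shows that the integrals are genuine: a Lebesgue integral of a
    non-integrable function is 0 by convention. It passes to the Bessel kernel by pointwise
    equality.\<close>
  have "set_integrable lborel {x<..} (\<lambda>y. (y - x) powr (2 * \<alpha> - 1) *\<^sub>R f y)"
    using assms(1,6) by (intro set_integrable_powr_scaleR[of _ _ _ M b] bound zero
        continuous_on_subset[OF cont]) auto
  moreover have "set_integrable lborel {x<..} (\<lambda>y. bessel_kernel 0 \<alpha> x y *\<^sub>R f y)
      \<longleftrightarrow> set_integrable lborel {x<..} (\<lambda>y. (y - x) powr (2 * \<alpha> - 1) *\<^sub>R f y)"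
    using assms(1,6) by (intro set_integrable_cong) (simp_all add: bessel_kernel_0)
  moreover have "set_lebesgue_integral lborel {x<..} (\<lambda>y. bessel_kernel 0 \<alpha> x y *\<^sub>R f y)
      = set_lebesgue_integral lborel {x<..} (\<lambda>y. (y - x) powr (2 * \<alpha> - 1) *\<^sub>R f y)"
    using assms(1,6) by (intro set_lebesgue_integral_cong) (simp_all add: bessel_kernel_0)
  ultimately show ?thesis
    by (simp add: bessel_integral_def liouville_integral_def)
qed

end
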